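(* Let $\{X_i\}_{i\in\mathbb{N}}$ be a sequence of real random variables such that $$c'=\sup_{i\in\mathbb{N}}\mathrm{Var}(X_i)+2\sum_{k\in\mathbb{N}}\sup_{i\in\mathbb{N}}|\mathrm{Cov}(X_i,X_{i+k})|<\infty .$$ Let $q_n>r_n$ be sequences of positive integers with $q_n=o(n)$, $r_n=o(q_n)$ and $q_n,r_n\to\infty$. Let $\sigma_n^2=\mathrm{Var}\big(\frac1{\sqrt n}\sum_{i=1}^nX_i\big)$, and let $\widehat\sigma_n^2=\mathrm{Var}\big(\frac1{\sqrt n}\sum_{l=1}^{m_n}\widetilde S_l\big)$, where $m_n=\lfloor n/(q_n+r_n)\rfloor$ and $\widetilde S_1,\dots,\widetilde S_{m_n}$ are mutually independent with $\widetilde S_l$ equal in distribution to the big-block sum $S_l=\sum_{i\in I_l}X_i$. Then $$\lim_{n\to\infty}\big(\sigma_n^2-\widehat\sigma_n^2\big)=0 .$$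
   Context: Big blocks: $I_l=\{(l-1)(q_n+r_n)+1,\dots,(l-1)(q_n+r_n)+q_n\}$ for $1\le l\le m_n$; consecutive big blocks are thus separated by small blocks of length $r_n$, and the remaining indices after $m_n(q_n+r_n)$ belong to no big block. *)

theory Defs
  imports "HOL-Probability.Probability" "HOL-Library.Landau_Symbols"
begin

definition covariance :: "'a measure \<Rightarrow> ('a \<Rightarrow> real) \<Rightarrow> ('a \<Rightarrow> real) \<Rightarrow> real" where
  "covariance M Y Z =
     prob_space.expectation M
       (\<lambda>\<omega>. (Y \<omega> - prob_space.expectation M Y) * (Z \<omega> - prob_space.expectation M Z))"

text \<open>The suprema and the series are taken in \<^typ>\<open>ennreal\<close>, so they may be infinite.
  Sequences of random variables are indexed by the positive integers (the value at 0 is never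
  used), and the series runs over the lags \<^term>\<open>Suc k\<close>, so lag 0 is excluded.\<close>

definition cov_bound :: "'a measure \<Rightarrow> (nat \<Rightarrow> 'a \<Rightarrow> real) \<Rightarrow> ennreal" where
  "cov_bound M X =
     (SUP i\<in>{1..}. ennreal (prob_space.variance M (X i)))
     + 2 * (\<Sum>k. SUP i\<in>{1..}. ennreal \<bar>covariance M (X i) (X (i + Suc k))\<bar>)"

definition big_block :: "nat \<Rightarrow> nat \<Rightarrow> nat \<Rightarrow> nat set" where
  "big_block q r l = {(l - 1) * (q + r) + 1 .. (l - 1) * (q + r) + q}"

definition num_blocks :: "nat \<Rightarrow> nat \<Rightarrow> nat \<Rightarrow> nat" where
  "num_blocks n q r = n div (q + r)"

definition block_sum :: "(nat \<Rightarrow> 'a \<Rightarrow> real) \<Rightarrow> nat \<Rightarrow> nat \<Rightarrow> nat \<Rightarrow> 'a \<Rightarrow> real" where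
  "block_sum X q r l = (\<lambda>\<omega>. \<Sum>i\<in>big_block q r l. X i \<omega>)"

text \<open>The independent copies of the block sums need not live on the space of the original
  sequence; they are given on a space \<^term>\<open>N\<close> of their own.\<close>

definition indep_block_copies ::
  "'a measure \<Rightarrow> (nat \<Rightarrow> 'a \<Rightarrow> real) \<Rightarrow> nat \<Rightarrow> nat \<Rightarrow> nat \<Rightarrow>
   'b measure \<Rightarrow> (nat \<Rightarrow> 'b \<Rightarrow> real) \<Rightarrow> bool" where
  "indep_block_copies M X n q r N T \<longleftrightarrow>
     prob_space N \<and>
     prob_space.indep_vars N (\<lambda>_. borel) T {1..num_blocks n q r} \<and>
     (\<forall>l\<in>{1..num_blocks n q r}. distr N borel (T l) = distr M borel (block_sum X q r l))"

end

theory Submission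
  imports Defs
begin

text \<open>Both variances, multiplied by \<open>n\<close>, are sums of the covariances
  \<open>Cov (X i) (X j)\<close>: the first over all pairs of indices in \<open>{1..n}\<close>, the second, by
  independence of the copies, only over pairs lying in a common big block. The difference is
  therefore the sum over the remaining pairs \<open>(i, j)\<close>. Such a pair either has a coordinate outside
  all big blocks, or has its coordinates in two different big blocks, which are more than
  \<open>r\<close> apart.

  Finiteness of \<^const>\<open>cov_bound\<close> provides a summable \<open>g\<close> with
  \<open>\<bar>Cov (X i) (X j)\<bar> \<le> g \<bar>i - j\<bar>\<close>
  (\<open>cov_bound_imp_summable_lag_bound\<close>). Summing along a row of the covariance matrix then costs at
  most twice the sum of \<open>g\<close>, and at most twice a tail of it when only distant indices are
  involved. As at most \<open>m r + q + r\<close> indices lie outside the \<open>m\<close> big blocks, pairs of the first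
  kind contribute \<open>O(m r + q + r)\<close>, and those of the second kind at most \<open>2 n\<close> times the
  tail of \<open>g\<close> from \<open>r\<close> on (\<open>double_sum_minus_blocks_le\<close>). Division by \<open>n\<close> leaves the explicit
  bound \<open>variance_minus_block_variance_le\<close>, built from \<open>r / q\<close>, \<open>q / n\<close> and that tail; all three
  tend to zero.\<close>

section \<open>Double sums with summable decay in the lag\<close>

text \<open>The distance \<open>|i - j|\<close>: with truncated subtraction one of the two summands vanishes.\<close>

definition lag :: "nat \<Rightarrow> nat \<Rightarrow> nat" where
  "lag i j = (i - j) + (j - i)"

lemma lag_commute: "lag i j = lag j i"
  by (simp add: lag_def)

text \<open>On either side of \<open>i\<close>, distinct indices have distinct lags, so the terms on that side are
  distinct terms of the tail of the series. The two sides account for the factor 2.\<close>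

lemma sum_lag_le_tail:
  fixes g :: "nat \<Rightarrow> real"
  assumes "finite A" and g: "summable g" "\<And>k. 0 \<le> g k"
  shows "(\<Sum>j\<in>{j\<in>A. d \<le> lag i j}. g (lag i j)) \<le> 2 * (\<Sum>k. g (k + d))"
proof -
  have one_side: "(\<Sum>j\<in>S. g (lag i j)) \<le> (\<Sum>k. g (k + d))"
    if S: "finite S" "\<And>j. j \<in> S \<Longrightarrow> d \<le> lag i j" and inj: "inj_on (lag i) S" for S
  proof -
    have inj': "inj_on (\<lambda>j. lag i j - d) S"
      using inj S(2) unfolding inj_on_def by (metis le_add_diff_inverse2)
    have "(\<Sum>j\<in>S. g (lag i j)) = (\<Sum>j\<in>S. g (lag i j - d + d))"
      using S(2) by simp
    also have "\<dots> = (\<Sum>k\<in>(\<lambda>j. lag i j - d) ` S. g (k + d))"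
      using inj' by (simp add: sum.reindex)
    also have "\<dots> \<le> (\<Sum>k. g (k + d))"
      using S(1) g by (intro sum_le_suminf) (auto simp: summable_iff_shift)
    finally show ?thesis .
  qed
  let ?L = "{j\<in>A. d \<le> lag i j \<and> j \<le> i}" and ?R = "{j\<in>A. d \<le> lag i j \<and> i < j}"
  have "{j\<in>A. d \<le> lag i j} = ?L \<union> ?R"
    by auto
  then have "(\<Sum>j\<in>{j\<in>A. d \<le> lag i j}. g (lag i j))
      = (\<Sum>j\<in>?L. g (lag i j)) + (\<Sum>j\<in>?R. g (lag i j))"
    using \<open>finite A\<close> by (simp only:) (rule sum.union_disjoint; auto)
  also have "\<dots> \<le> (\<Sum>k. g (k + d)) + (\<Sum>k. g (k + d))"
    using \<open>finite A\<close> by (intro add_mono one_side) (auto simp: inj_on_def lag_def)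
  finally show ?thesis
    by simp
qed

text \<open>The pairs outside the diagonal squares \<open>B l \<times> B l\<close> are covered by the rows and the columns of
  the indices belonging to no block, together with all pairs at distance at least \<open>d\<close>. Each row
  and each column of the first sort costs at most \<open>2 * suminf g\<close>, and each row of the second at
  most twice the tail.\<close>

lemma double_sum_minus_blocks_le:
  fixes c :: "nat \<Rightarrow> nat \<Rightarrow> real" and g :: "nat \<Rightarrow> real" and B :: "'l \<Rightarrow> nat set"
  assumes A: "finite A" and L: "finite L"
    and sub: "\<And>l. l \<in> L \<Longrightarrow> B l \<subseteq> A"
    and disj: "\<And>l l'. \<lbrakk>l \<in> L; l' \<in> L; l \<noteq> l'\<rbrakk> \<Longrightarrow> B l \<inter> B l' = {}"
    and gap: "\<And>l l' i j. \<lbrakk>l \<in> L; l' \<in> L; l \<noteq> l'; i \<in> B l; j \<in> B l'\<rbrakk> \<Longrightarrow> d \<le> lag i j"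
    and g: "summable g" "\<And>k. 0 \<le> g k"
    and c: "\<And>i j. \<lbrakk>i \<in> A; j \<in> A\<rbrakk> \<Longrightarrow> \<bar>c i j\<bar> \<le> g (lag i j)"
  shows "\<bar>(\<Sum>i\<in>A. \<Sum>j\<in>A. c i j) - (\<Sum>l\<in>L. \<Sum>i\<in>B l. \<Sum>j\<in>B l. c i j)\<bar>
     \<le> 4 * real (card (A - (\<Union>l\<in>L. B l))) * suminf g + 2 * real (card A) * (\<Sum>k. g (k + d))"
proof -
  define E where "E = A - (\<Union>l\<in>L. B l)"
  define D where "D = (\<Union>l\<in>L. B l \<times> B l)"
  define F where "F = (SIGMA i:A. {j\<in>A. d \<le> lag i j})"
  let ?c = "\<lambda>(i, j). c i j" and ?g = "\<lambda>(i, j). g (lag i j)"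
  have finB: "finite (B l)" if "l \<in> L" for l
    using sub[OF that] A finite_subset by blast
  have fin: "finite E" "finite F"
    using A by (auto simp: E_def F_def)
  have DA: "D \<subseteq> A \<times> A"
    using sub unfolding D_def by blast
  have "sum ?c D = (\<Sum>l\<in>L. sum ?c (B l \<times> B l))"
    unfolding D_def using L finB disj by (intro sum.UNION_disjoint) auto
  also have "\<dots> = (\<Sum>l\<in>L. \<Sum>i\<in>B l. \<Sum>j\<in>B l. c i j)"
    by (simp add: sum.cartesian_product)
  finally have "(\<Sum>i\<in>A. \<Sum>j\<in>A. c i j) - (\<Sum>l\<in>L. \<Sum>i\<in>B l. \<Sum>j\<in>B l. c i j) = sum ?c (A \<times> A - D)"
    using A DA by (simp add: sum.cartesian_product sum_diff)
  also have "\<bar>\<dots>\<bar> \<le> sum (\<lambda>p. \<bar>?c p\<bar>) (A \<times> A - D)"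
    by (rule sum_abs)
  also have "\<dots> \<le> sum ?g (A \<times> A - D)"
    using c by (intro sum_mono) auto
  also have "\<dots> \<le> sum ?g (E \<times> A \<union> A \<times> E \<union> F)"
  proof (rule sum_mono2)
    show "A \<times> A - D \<subseteq> E \<times> A \<union> A \<times> E \<union> F"
      using gap unfolding D_def E_def F_def by blast
  qed (use A fin g in auto)
  also have "\<dots> \<le> sum ?g (E \<times> A) + sum ?g (A \<times> E) + sum ?g F"
  proof -
    have union: "sum ?g (S \<union> S') \<le> sum ?g S + sum ?g S'" if "finite S" "finite S'" for S S'
    proof -
      have "0 \<le> sum ?g (S \<inter> S')"
        using g by (intro sum_nonneg) auto
      then show ?thesis
        using sum.union_inter[OF that, of ?g] by linarith
    qed
    have "sum ?g (E \<times> A \<union> A \<times> E \<union> F) \<le> sum ?g (E \<times> A \<union> A \<times> E) + sum ?g F"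
      using A fin by (intro union) auto
    moreover have "sum ?g (E \<times> A \<union> A \<times> E) \<le> sum ?g (E \<times> A) + sum ?g (A \<times> E)"
      using A fin by (intro union) auto
    ultimately show ?thesis
      by linarith
  qed
  also have "sum ?g (A \<times> E) = sum ?g (E \<times> A)"
    by (rule sum.reindex_bij_witness[of _ prod.swap prod.swap]) (auto simp: lag_commute)
  also have "sum ?g (E \<times> A) = (\<Sum>i\<in>E. \<Sum>j\<in>A. g (lag i j))"
    by (simp add: sum.cartesian_product)
  also have "\<dots> \<le> (\<Sum>i\<in>E. 2 * suminf g)"
    using sum_lag_le_tail[OF A g, where d = 0] by (intro sum_mono) simp
  also have "sum ?g F = (\<Sum>i\<in>A. \<Sum>j\<in>{j\<in>A. d \<le> lag i j}. g (lag i j))"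
    unfolding F_def using A by (subst sum.Sigma) auto
  also have "\<dots> \<le> (\<Sum>i\<in>A. 2 * (\<Sum>k. g (k + d)))"
    using sum_lag_le_tail[OF A g] by (intro sum_mono)
  finally show ?thesis
    by (simp add: E_def algebra_simps)
qed

section \<open>Geometry of the big blocks\<close>

lemma big_block_gap:
  assumes "l \<ge> 1" "l' \<ge> 1" "l \<noteq> l'" "i \<in> big_block q r l" "j \<in> big_block q r l'"
  shows "r < lag i j"
proof -
  (* by symmetry it suffices to consider the block further to the left *)
  have ordered: "i' + r < j'"
    if "k \<ge> 1" "k < k'" "i' \<in> big_block q r k" "j' \<in> big_block q r k'" for k k' i' j'
  proof -
    have "k * (q + r) \<le> (k' - 1) * (q + r)"
      using that by (intro mult_right_mono) auto
    moreover have "k * (q + r) = (k - 1) * (q + r) + (q + r)"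
      using that by (cases k) auto
    ultimately show ?thesis
      using that by (auto simp: big_block_def)
  qed
  show ?thesis
    using ordered[of l l' i j] ordered[of l' l j i] assms by (force simp: lag_def)
qed

lemma big_block_disjoint:
  assumes "l \<ge> 1" "l' \<ge> 1" "l \<noteq> l'"
  shows "big_block q r l \<inter> big_block q r l' = {}"
  using big_block_gap[OF assms] by (fastforce simp: lag_def)

lemma big_block_subset:
  assumes "l \<in> {1..num_blocks n q r}"
  shows "big_block q r l \<subseteq> {1..n}"
proof -
  have "l * (q + r) \<le> num_blocks n q r * (q + r)"
    using assms by (intro mult_right_mono) auto
  also have "\<dots> \<le> n"
    by (simp add: num_blocks_def)
  finally have "(l - 1) * (q + r) + (q + r) \<le> n"
    using assms by (cases l) auto
  then show ?thesis
    by (auto simp: big_block_def)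
qed

text \<open>Besides the small blocks of length \<open>r\<close>, only the incomplete period at the end of \<open>{1..n}\<close>,
  shorter than \<open>q + r\<close>, is uncovered.\<close>

lemma card_outside_big_blocks:
  assumes "q > 0"
  shows "card ({1..n} - (\<Union>l\<in>{1..num_blocks n q r}. big_block q r l))
      \<le> num_blocks n q r * r + (q + r)"
proof -
  let ?m = "num_blocks n q r"
  let ?U = "\<Union>l\<in>{1..?m}. big_block q r l"
  have "card ?U = (\<Sum>l\<in>{1..?m}. card (big_block q r l))"
    using big_block_disjoint by (intro card_UN_disjoint) (auto simp: big_block_def)
  then have U: "card ?U = ?m * q"
    by (simp add: big_block_def)
  have "?U \<subseteq> {1..n}"
    using big_block_subset by blast
  then have "card ({1..n} - ?U) = card {1..n} - card ?U"
    using finite_subset[OF _ finite_atLeastAtMost] by (intro card_Diff_subset)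
  then have "card ({1..n} - ?U) = n - ?m * q"
    unfolding U by simp
  moreover have "n mod (q + r) < q + r"
    using assms by (intro mod_less_divisor) simp
  then have "n \<le> ?m * (q + r) + (q + r)"
    using div_mult_mod_eq[of n "q + r"] unfolding num_blocks_def by linarith
  ultimately show ?thesis
    by (simp add: algebra_simps)
qed

section \<open>Variances of sums\<close>

lemma variance_eq_covariance: "prob_space.variance M Y = covariance M Y Y"
  by (simp add: covariance_def power2_eq_square)

lemma covariance_commute: "covariance M Y Z = covariance M Z Y"
  by (simp add: covariance_def mult.commute)

lemma integrable_mult_of_squares:
  fixes f h :: "'a \<Rightarrow> real"
  assumes [measurable]: "f \<in> borel_measurable M" "h \<in> borel_measurable M"
    and sq: "integrable M (\<lambda>x. (f x)\<^sup>2)" "integrable M (\<lambda>x. (h x)\<^sup>2)"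
  shows "integrable M (\<lambda>x. f x * h x)"
proof (rule Bochner_Integration.integrable_bound)
  show "integrable M (\<lambda>x. (f x)\<^sup>2 + (h x)\<^sup>2)"
    using sq by simp
  have "\<bar>a * b\<bar> \<le> a\<^sup>2 + b\<^sup>2" for a b :: real
  proof -
    have "2 * \<bar>a * b\<bar> \<le> a\<^sup>2 + b\<^sup>2"
      using sum_squares_bound[of "\<bar>a\<bar>" "\<bar>b\<bar>"] by (simp add: abs_mult)
    then show ?thesis
      using abs_ge_zero[of "a * b"] by linarith
  qed
  then show "AE x in M. norm (f x * h x) \<le> norm ((f x)\<^sup>2 + (h x)\<^sup>2)"
    by simp
qed simp

context prob_space
begin

lemma integrable_of_square:
  fixes f :: "'a \<Rightarrow> real"
  assumes "f \<in> borel_measurable M" "integrable M (\<lambda>x. (f x)\<^sup>2)"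
  shows "integrable M f"
  using square_integrable_imp_integrable assms by blast

lemma integrable_square_centred:
  fixes f :: "'a \<Rightarrow> real"
  assumes "f \<in> borel_measurable M" "integrable M (\<lambda>x. (f x)\<^sup>2)"
  shows "integrable M (\<lambda>x. (f x - a)\<^sup>2)"
  using assms integrable_of_square[OF assms] by (simp add: power2_diff)

lemma variance_sum:
  fixes Y :: "'i \<Rightarrow> 'a \<Rightarrow> real"
  assumes "finite I"
    and meas: "\<And>i. i \<in> I \<Longrightarrow> Y i \<in> borel_measurable M"
    and sq: "\<And>i. i \<in> I \<Longrightarrow> integrable M (\<lambda>x. (Y i x)\<^sup>2)"
  shows "variance (\<lambda>x. \<Sum>i\<in>I. Y i x) = (\<Sum>i\<in>I. \<Sum>j\<in>I. covariance M (Y i) (Y j))"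
proof -
  have mean: "expectation (\<lambda>x. \<Sum>i\<in>I. Y i x) = (\<Sum>i\<in>I. expectation (Y i))"
    by (rule Bochner_Integration.integral_sum[OF integrable_of_square[OF meas sq]])
  have prod: "integrable M (\<lambda>x. (Y i x - expectation (Y i)) * (Y j x - expectation (Y j)))"
    if "i \<in> I" "j \<in> I" for i j
    using that by (intro integrable_mult_of_squares integrable_square_centred
        borel_measurable_diff borel_measurable_const meas sq)
  have "variance (\<lambda>x. \<Sum>i\<in>I. Y i x)
      = expectation (\<lambda>x. \<Sum>i\<in>I. \<Sum>j\<in>I. (Y i x - expectation (Y i)) * (Y j x - expectation (Y j)))"
    unfolding mean by (simp add: sum_subtractf[symmetric] power2_eq_square sum_product)
  also have "\<dots> = (\<Sum>i\<in>I. \<Sum>j\<in>I. covariance M (Y i) (Y j))"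
    using prod by (simp add: covariance_def)
  finally show ?thesis .
qed

lemma covariance_indep_eq_0:
  fixes Y :: "'i \<Rightarrow> 'a \<Rightarrow> real"
  assumes ind: "indep_vars (\<lambda>_. borel) Y I" and ij: "i \<in> I" "j \<in> I" "i \<noteq> j"
    and int: "integrable M (Y i)" "integrable M (Y j)"
  shows "covariance M (Y i) (Y j) = 0"
proof -
  have "indep_vars (\<lambda>_. borel) Y {i, j}"
    using ind ij by (auto intro: indep_vars_subset)
  then have "indep_vars (\<lambda>_. borel) (\<lambda>k x. Y k x - expectation (Y k)) {i, j}"
    by (rule indep_vars_compose2) simp
  then have "expectation (\<lambda>x. \<Prod>k\<in>{i, j}. Y k x - expectation (Y k))
      = (\<Prod>k\<in>{i, j}. expectation (\<lambda>x. Y k x - expectation (Y k)))"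
    using int by (intro indep_vars_lebesgue_integral) auto
  then show ?thesis
    using ij int by (simp add: covariance_def prob_space)
qed

lemma variance_sum_indep:
  fixes Y :: "'i \<Rightarrow> 'a \<Rightarrow> real"
  assumes fin: "finite I" and ind: "indep_vars (\<lambda>_. borel) Y I"
    and sq: "\<And>i. i \<in> I \<Longrightarrow> integrable M (\<lambda>x. (Y i x)\<^sup>2)"
  shows "variance (\<lambda>x. \<Sum>i\<in>I. Y i x) = (\<Sum>i\<in>I. variance (Y i))"
proof -
  have meas: "Y i \<in> borel_measurable M" if "i \<in> I" for i
    using ind that by (simp add: indep_vars_def2)
  have zero: "covariance M (Y i) (Y j) = 0" if "i \<in> I" "j \<in> I" "i \<noteq> j" for i j
    using ind that integrable_of_square[OF meas sq, OF that(1) that(1)]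
      integrable_of_square[OF meas sq, OF that(2) that(2)]
    by (rule covariance_indep_eq_0)
  have "variance (\<lambda>x. \<Sum>i\<in>I. Y i x) = (\<Sum>i\<in>I. \<Sum>j\<in>I. covariance M (Y i) (Y j))"
    using fin meas sq by (rule variance_sum)
  also have "\<dots> = (\<Sum>i\<in>I. \<Sum>j\<in>I. if i = j then variance (Y i) else 0)"
    using zero by (intro sum.cong refl) (auto simp: variance_eq_covariance)
  also have "\<dots> = (\<Sum>i\<in>I. variance (Y i))"
    using fin by simp
  finally show ?thesis .
qed

lemma variance_scale:
  fixes Y :: "'a \<Rightarrow> real"
  shows "variance (\<lambda>x. a * Y x) = a\<^sup>2 * variance Y"
  by (simp add: right_diff_distrib[symmetric] power_mult_distrib)

lemma integrable_square_sum:
  fixes Y :: "'i \<Rightarrow> 'a \<Rightarrow> real"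
  assumes "\<And>i. i \<in> I \<Longrightarrow> Y i \<in> borel_measurable M"
    and "\<And>i. i \<in> I \<Longrightarrow> integrable M (\<lambda>x. (Y i x)\<^sup>2)"
  shows "integrable M (\<lambda>x. (\<Sum>i\<in>I. Y i x)\<^sup>2)"
  unfolding power2_eq_square sum_product
  by (intro Bochner_Integration.integrable_sum integrable_mult_of_squares assms)

end

text \<open>The copies of the block sums are only known through their distribution; square integrability,
  and the variance, depend on nothing else.\<close>

lemma distr_eq_integrable_square:
  fixes Y :: "'a \<Rightarrow> real" and Z :: "'b \<Rightarrow> real"
  assumes eq: "distr M borel Y = distr N borel Z"
    and [measurable]: "Y \<in> borel_measurable M" "Z \<in> borel_measurable N"
    and int: "integrable N (\<lambda>x. (Z x)\<^sup>2)"
  shows "integrable M (\<lambda>x. (Y x)\<^sup>2)"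
proof -
  have "integrable (distr N borel Z) (\<lambda>y. y\<^sup>2)"
    using int by (subst integrable_distr_eq) auto
  then have "integrable (distr M borel Y) (\<lambda>y. y\<^sup>2)"
    by (simp add: eq)
  then show ?thesis
    by (subst (asm) integrable_distr_eq) auto
qed

lemma distr_eq_variance:
  fixes Y :: "'a \<Rightarrow> real" and Z :: "'b \<Rightarrow> real"
  assumes eq: "distr M borel Y = distr N borel Z"
    and [measurable]: "Y \<in> borel_measurable M" "Z \<in> borel_measurable N"
  shows "prob_space.variance M Y = prob_space.variance N Z"
proof -
  have transfer: "(\<integral>x. f (Y x) \<partial>M) = (\<integral>x. f (Z x) \<partial>N)"
    if [measurable]: "f \<in> borel_measurable borel" for f :: "real \<Rightarrow> real"
    using arg_cong[OF eq, of "\<lambda>D. \<integral>y. f y \<partial>D"] by (simp add: integral_distr)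
  have "(\<integral>x. Y x \<partial>M) = (\<integral>x. Z x \<partial>N)"
    using transfer[of "\<lambda>y. y"] by simp
  then show ?thesis
    using transfer[of "\<lambda>y. (y - (\<integral>x. Z x \<partial>N))\<^sup>2"] by simp
qed

section \<open>The comparison\<close>

text \<open>The function \<open>g\<close> lists the suprema that make up \<^const>\<open>cov_bound\<close>: the variances at lag 0 and
  the covariances at each positive lag, the latter being indexed from 0 in the series.\<close>

lemma cov_bound_imp_summable_lag_bound:
  assumes "cov_bound M X < \<infinity>"
  obtains g :: "nat \<Rightarrow> real" where "summable g" "\<And>k. 0 \<le> g k"
    "\<And>i j. \<lbrakk>i \<ge> 1; j \<ge> 1\<rbrakk> \<Longrightarrow> \<bar>covariance M (X i) (X j)\<bar> \<le> g (lag i j)"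
proof -
  define V where "V = (SUP i\<in>{1..}. ennreal (prob_space.variance M (X i)))"
  define a where "a k = (SUP i\<in>{1..}. ennreal \<bar>covariance M (X i) (X (i + Suc k))\<bar>)" for k
  define g where "g k = (case k of 0 \<Rightarrow> enn2real V | Suc k' \<Rightarrow> enn2real (a k'))" for k
  have "V + 2 * (\<Sum>k. a k) < top"
    using assms by (simp add: cov_bound_def V_def a_def)
  then have V: "V < top" and "2 * (\<Sum>k. a k) < top"
    by auto
  then have suma: "(\<Sum>k. a k) < top"
    by (auto simp: ennreal_mult_less_top)
  have a: "a k < top" for k
    using ennreal_suminf_lessD[OF suma] .
  have "(\<Sum>k. ennreal (enn2real (a k))) \<noteq> top"
    using suma a by simp
  then have "summable (\<lambda>k. enn2real (a k))"
    by (intro summable_suminf_not_top) auto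
  then have "summable (\<lambda>k. g (Suc k))"
    by (simp add: g_def)
  then have sg: "summable g"
    by (simp add: summable_Suc_iff)
  have nonneg: "0 \<le> g k" for k
    by (simp add: g_def split: nat.split)
  have diag: "\<bar>covariance M (X i) (X i)\<bar> \<le> g 0" if "i \<ge> 1" for i
  proof -
    have "ennreal (prob_space.variance M (X i)) \<le> V"
      unfolding V_def using that by (intro SUP_upper) auto
    then have "prob_space.variance M (X i) \<le> enn2real V"
      using V by (metis enn2real_mono enn2real_ennreal integral_nonneg_AE AE_I2 zero_le_power2)
    moreover have "0 \<le> prob_space.variance M (X i)"
      by (intro integral_nonneg_AE) simp
    ultimately show ?thesis
      by (simp add: variance_eq_covariance[symmetric] g_def)
  qed
  have upper: "\<bar>covariance M (X i) (X j)\<bar> \<le> g (lag i j)" if "i \<ge> 1" "i < j" for i j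
  proof -
    obtain k where k: "j = i + Suc k"
      using less_imp_Suc_add[OF \<open>i < j\<close>] by auto
    have "ennreal \<bar>covariance M (X i) (X j)\<bar> \<le> a k"
      unfolding a_def k using that(1) by (intro SUP_upper) auto
    then have "\<bar>covariance M (X i) (X j)\<bar> \<le> enn2real (a k)"
      using a[of k] by (metis enn2real_mono enn2real_ennreal abs_ge_zero)
    then show ?thesis
      by (simp add: g_def lag_def k)
  qed
  show ?thesis
  proof (rule that[OF sg nonneg])
    fix i j :: nat assume "i \<ge> 1" "j \<ge> 1"
    then show "\<bar>covariance M (X i) (X j)\<bar> \<le> g (lag i j)"
    proof (cases i j rule: linorder_cases)
      case equal
      then show ?thesis
        using diag[OF \<open>i \<ge> 1\<close>] by (simp add: lag_def)
    next
      case greater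
      then show ?thesis
        unfolding lag_commute[of i] covariance_commute[of M "X i"]
        using upper[OF \<open>j \<ge> 1\<close>] by blast
    qed (rule upper)
  qed
qed

lemma variance_block_copies:
  assumes "prob_space M"
    and meas: "\<And>i. i \<ge> 1 \<Longrightarrow> X i \<in> borel_measurable M"
    and sq: "\<And>i. i \<ge> 1 \<Longrightarrow> integrable M (\<lambda>\<omega>. (X i \<omega>)\<^sup>2)"
    and copies: "indep_block_copies M X n q r N T"
  shows "prob_space.variance N (\<lambda>\<omega>. \<Sum>l=1..num_blocks n q r. T l \<omega>)
    = (\<Sum>l=1..num_blocks n q r. \<Sum>i\<in>big_block q r l. \<Sum>j\<in>big_block q r l. covariance M (X i) (X j))"
proof -
  interpret M: prob_space M by fact
  interpret N: prob_space N
    using copies by (simp add: indep_block_copies_def)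
  have ind: "N.indep_vars (\<lambda>_. borel) T {1..num_blocks n q r}"
    using copies by (simp add: indep_block_copies_def)
  have pos: "i \<ge> 1" if "i \<in> big_block q r l" for i l
    using that by (simp add: big_block_def)
  have measS: "block_sum X q r l \<in> borel_measurable M" for l
    unfolding block_sum_def using meas pos by (intro borel_measurable_sum) auto
  have sqS: "integrable M (\<lambda>\<omega>. (block_sum X q r l \<omega>)\<^sup>2)" for l
    unfolding block_sum_def using meas sq pos by (intro M.integrable_square_sum) auto
  have measT: "T l \<in> borel_measurable N" and distrT: "distr N borel (T l) = distr M borel (block_sum X q r l)"
    if "l \<in> {1..num_blocks n q r}" for l
    using copies that ind by (auto simp: indep_block_copies_def N.indep_vars_def2)
  have "N.variance (\<lambda>\<omega>. \<Sum>l=1..num_blocks n q r. T l \<omega>) = (\<Sum>l=1..num_blocks n q r. N.variance (T l))"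
    using ind distr_eq_integrable_square[OF distrT measT measS sqS]
    by (intro N.variance_sum_indep) auto
  also have "\<dots> = (\<Sum>l=1..num_blocks n q r. M.variance (block_sum X q r l))"
    using distr_eq_variance[OF distrT measT measS] by (intro sum.cong) auto
  also have "\<dots> = (\<Sum>l=1..num_blocks n q r. \<Sum>i\<in>big_block q r l. \<Sum>j\<in>big_block q r l. covariance M (X i) (X j))"
    unfolding block_sum_def using meas sq pos
    by (intro sum.cong refl M.variance_sum) (auto simp: big_block_def)
  finally show ?thesis .
qed

text \<open>The proportion of indices outside the big blocks is at most \<open>r / q + 2 q / n\<close>: the \<open>m\<close> big
  blocks fit into \<open>{1..n}\<close>, so \<open>m q \<le> n\<close> and the small blocks make up at most \<open>r / q\<close>, while
  the last incomplete period has length below \<open>q + r \<le> 2 q\<close>.\<close>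

lemma variance_minus_block_variance_le:
  fixes g :: "nat \<Rightarrow> real"
  assumes "prob_space M"
    and meas: "\<And>i. i \<ge> 1 \<Longrightarrow> X i \<in> borel_measurable M"
    and sq: "\<And>i. i \<ge> 1 \<Longrightarrow> integrable M (\<lambda>\<omega>. (X i \<omega>)\<^sup>2)"
    and g: "summable g" "\<And>k. 0 \<le> g k"
      "\<And>i j. \<lbrakk>i \<ge> 1; j \<ge> 1\<rbrakk> \<Longrightarrow> \<bar>covariance M (X i) (X j)\<bar> \<le> g (lag i j)"
    and n: "n \<ge> 1" and qr: "r < q"
    and copies: "indep_block_copies M X n q r N T"
  shows "\<bar>prob_space.variance M (\<lambda>\<omega>. 1 / sqrt (real n) * (\<Sum>i=1..n. X i \<omega>))
      - prob_space.variance N (\<lambda>\<omega>. 1 / sqrt (real n) * (\<Sum>l=1..num_blocks n q r. T l \<omega>))\<bar>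
    \<le> 4 * suminf g * (real r / real q + 2 * (real q / real n)) + 2 * (\<Sum>k. g (k + r))"
    (is "\<bar>?d\<bar> \<le> _")
proof -
  interpret M: prob_space M by fact
  interpret N: prob_space N
    using copies by (simp add: indep_block_copies_def)
  let ?m = "num_blocks n q r"
  let ?e = "real (card ({1..n} - (\<Union>l\<in>{1..?m}. big_block q r l)))"
  let ?D = "(\<Sum>i=1..n. \<Sum>j=1..n. covariance M (X i) (X j))
    - (\<Sum>l=1..?m. \<Sum>i\<in>big_block q r l. \<Sum>j\<in>big_block q r l. covariance M (X i) (X j))"
  have "M.variance (\<lambda>\<omega>. \<Sum>i=1..n. X i \<omega>) = (\<Sum>i=1..n. \<Sum>j=1..n. covariance M (X i) (X j))"
    using meas sq by (intro M.variance_sum) auto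
  moreover have "N.variance (\<lambda>\<omega>. \<Sum>l=1..?m. T l \<omega>)
      = (\<Sum>l=1..?m. \<Sum>i\<in>big_block q r l. \<Sum>j\<in>big_block q r l. covariance M (X i) (X j))"
    using assms(1-3) copies by (rule variance_block_copies)
  ultimately have d: "?d = ?D / real n"
    using n M.variance_scale[of "1 / sqrt (real n)" "\<lambda>\<omega>. \<Sum>i=1..n. X i \<omega>"]
      N.variance_scale[of "1 / sqrt (real n)" "\<lambda>\<omega>. \<Sum>l=1..?m. T l \<omega>"]
    by (simp only: power_divide real_sqrt_pow2 of_nat_0_le_iff) (simp add: diff_divide_distrib)
  have "\<bar>?D\<bar> \<le> 4 * ?e * suminf g + 2 * real (card {1..n}) * (\<Sum>k. g (k + r))"
    using g big_block_subset big_block_disjoint less_imp_le[OF big_block_gap]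
    by (intro double_sum_minus_blocks_le) auto
  then have "\<bar>?D\<bar> / real n \<le> (4 * ?e * suminf g + 2 * real n * (\<Sum>k. g (k + r))) / real n"
    by (intro divide_right_mono) auto
  then have d_le: "\<bar>?d\<bar> \<le> 4 * suminf g * (?e / real n) + 2 * (\<Sum>k. g (k + r))"
    unfolding d using n by (simp add: add_divide_distrib mult_ac)
  have e: "?e / real n \<le> real r / real q + 2 * (real q / real n)"
  proof -
    have "?m * q \<le> ?m * (q + r)"
      by simp
    also have "\<dots> \<le> n"
      by (simp add: num_blocks_def)
    finally have "real ?m * real q \<le> real n"
      by (metis of_nat_mult of_nat_le_iff)
    then have "real r * (real ?m * real q) \<le> real r * real n"
      by (intro mult_left_mono) auto
    then have "real ?m * real r / real n \<le> real r / real q"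
      using n qr by (simp add: field_simps)
    moreover have "(real q + real r) / real n \<le> 2 * (real q / real n)"
      using n qr by (simp add: divide_simps)
    moreover have "?e \<le> real (?m * r + (q + r))"
      using card_outside_big_blocks[of q n r] qr by (simp only: of_nat_le_iff)
    then have "?e / real n \<le> real (?m * r + (q + r)) / real n"
      by (rule divide_right_mono) simp
    then have "?e / real n \<le> real ?m * real r / real n + (real q + real r) / real n"
      by (simp add: add_divide_distrib)
    ultimately show ?thesis
      by linarith
  qed
  have "4 * suminf g * (?e / real n)
      \<le> 4 * suminf g * (real r / real q + 2 * (real q / real n))"
    using g by (intro mult_left_mono[OF e]) (simp add: suminf_nonneg)
  then show ?thesis
    by (rule order_trans[OF d_le add_right_mono])
qed

theorem lemmaC1:
  fixes M :: "'a measure" and X :: "nat \<Rightarrow> 'a \<Rightarrow> real"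
    and q r :: "nat \<Rightarrow> nat"
    and N :: "nat \<Rightarrow> 'b measure" and T :: "nat \<Rightarrow> nat \<Rightarrow> 'b \<Rightarrow> real"
  assumes "prob_space M"
    and "\<And>i. i \<ge> 1 \<Longrightarrow> X i \<in> borel_measurable M"
    and "\<And>i. i \<ge> 1 \<Longrightarrow> integrable M (\<lambda>\<omega>. (X i \<omega>)\<^sup>2)"
    and "cov_bound M X < \<infinity>"
    and "\<And>n. n \<ge> 1 \<Longrightarrow> 0 < r n \<and> r n < q n"
    and "(\<lambda>n. real (q n)) \<in> o(\<lambda>n. real n)"
    and "(\<lambda>n. real (r n)) \<in> o(\<lambda>n. real (q n))"
    and "filterlim q at_top sequentially"
    and "filterlim r at_top sequentially"
    and "\<And>n. n \<ge> 1 \<Longrightarrow> indep_block_copies M X n (q n) (r n) (N n) (T n)"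
  shows "(\<lambda>n. prob_space.variance M (\<lambda>\<omega>. 1 / sqrt (real n) * (\<Sum>i=1..n. X i \<omega>))
            - prob_space.variance (N n)
                (\<lambda>\<omega>. 1 / sqrt (real n) * (\<Sum>l=1..num_blocks n (q n) (r n). T n l \<omega>)))
         \<longlonglongrightarrow> 0"
proof -
  obtain g :: "nat \<Rightarrow> real" where g: "summable g" "\<And>k. 0 \<le> g k"
      "\<And>i j. \<lbrakk>i \<ge> 1; j \<ge> 1\<rbrakk> \<Longrightarrow> \<bar>covariance M (X i) (X j)\<bar> \<le> g (lag i j)"
    using cov_bound_imp_summable_lag_bound[OF assms(4)] by blast
  let ?b = "\<lambda>n. 4 * suminf g * (real (r n) / real (q n) + 2 * (real (q n) / real n))
    + 2 * (\<Sum>k. g (k + r n))"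
  have rq: "(\<lambda>n. real (r n) / real (q n)) \<longlonglongrightarrow> 0"
    using assms(7) by (rule smalloD_tendsto)
  have qn: "(\<lambda>n. real (q n) / real n) \<longlonglongrightarrow> 0"
    using assms(6) by (rule smalloD_tendsto)
  have tail: "(\<lambda>n. \<Sum>k. g (k + r n)) \<longlonglongrightarrow> 0"
    using filterlim_compose[OF suminf_exist_split2[OF g(1)] assms(9)] .
  have "?b \<longlonglongrightarrow> 4 * suminf g * (0 + 2 * 0) + 2 * 0"
    by (intro tendsto_intros rq qn tail)
  then have b: "?b \<longlonglongrightarrow> 0"
    by simp
  show ?thesis
  proof (rule Lim_null_comparison[OF _ b])
    show "\<forall>\<^sub>F n in sequentially.
      norm (prob_space.variance M (\<lambda>\<omega>. 1 / sqrt (real n) * (\<Sum>i=1..n. X i \<omega>))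
            - prob_space.variance (N n)
                (\<lambda>\<omega>. 1 / sqrt (real n) * (\<Sum>l=1..num_blocks n (q n) (r n). T n l \<omega>))) \<le> ?b n"
      using eventually_ge_at_top[of "1::nat"]
    proof eventually_elim
      case (elim n)
      then show ?case
        unfolding real_norm_def
        using assms(5) by (intro variance_minus_block_variance_le[OF assms(1-3) g _ _ assms(10)]) auto
    qed
  qed
qed

end
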